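(* For a skew left brace $(B,+,\circ)$, $\mathrm{FCI}(B)$ is a subgroup of $(B,\circ)$. Moreover, if $B$ is two-sided, symmetric or $\lambda$-homomorphic, then $\mathrm{FCI}(B)$ is a sub-skew brace of $B$.
   Context: A skew left brace is a set $B$ (possibly infinite) with two group structures $(B,+)$ and $(B,\circ)$ (neither assumed abelian) such that $a\circ(b+c)=(a\circ b)-a+(a\circ c)$ for all $a,b,c\in B$, where $-a$ is the inverse of $a$ in $(B,+)$. The identities of the two groups coincide and are denoted by $1$. Put $\lambda_a(b):=-a+(a\circ b)$, $a*b:=\lambda_a(b)-b$ and $[a,b]^+:=a+b-a-b$; each $\lambda_a$ is an automorphism of $(B,+)$. A sub-skew brace of $B$ is a subset $H$ such that $(H,+,\circ)$ is itself a skew left brace. The brace centralizer of $x\in B$ is $\mathrm{Cb}_B(x):=\{b\in B\mid x*b=b*x=[x,b]^+=1\}$; it is a subgroup of $(B,\circ)$. $\mathrm{FCI}(B)$ is the set of all $x\in B$ such that the index $[(B,\circ):\mathrm{Cb}_B(x)]$ is finite. $B$ is two-sided if also $(b+c)\circ a=(b\circ a)-a+(c\circ a)$ for all $a,b,c\in B$; symmetric if $(B,\circ,+)$ (roles of the two operations exchanged) is also a skew left brace; $\lambda$-homomorphic if $a\mapsto\lambda_a$ is a group homomorphism from $(B,+)$ to $\mathrm{Aut}(B,+)$. *)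

theory Defs
  imports "HOL-Algebra.Coset" "HOL-Algebra.Bij"
begin

text \<open>
  A skew left brace is represented by two group records \<open>A\<close> (the group \<open>(B,+)\<close>) and
  \<open>M\<close> (the group \<open>(B,\<circ>)\<close>) on the same carrier. Neither group is assumed commutative,
  so the additive group is written with the multiplicative notation \<open>\<otimes>\<^bsub>A\<^esub>\<close>,
  \<open>inv\<^bsub>A\<^esub>\<close>, \<open>\<one>\<^bsub>A\<^esub>\<close> of \<open>HOL-Algebra\<close>.
\<close>

locale skew_left_brace = add: group A + circ: group M
  for A :: "('a, 'b) monoid_scheme" and M :: "('a, 'c) monoid_scheme" +
  assumes carrier_eq: "carrier M = carrier A"
    and brace_law: "\<lbrakk>a \<in> carrier A; b \<in> carrier A; c \<in> carrier A\<rbrakk> \<Longrightarrow>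
      a \<otimes>\<^bsub>M\<^esub> (b \<otimes>\<^bsub>A\<^esub> c) = (a \<otimes>\<^bsub>M\<^esub> b) \<otimes>\<^bsub>A\<^esub> inv\<^bsub>A\<^esub> a \<otimes>\<^bsub>A\<^esub> (a \<otimes>\<^bsub>M\<^esub> c)"

text \<open>
  The map \<open>\<lambda>\<^sub>a\<close> is made extensional (undefined outside the carrier), as required of the
  elements of \<^const>\<open>AutoGroup\<close>.
\<close>

definition lambda_map ::
    "('a, 'b) monoid_scheme \<Rightarrow> ('a, 'c) monoid_scheme \<Rightarrow> 'a \<Rightarrow> 'a \<Rightarrow> 'a" where
  "lambda_map A M a = (\<lambda>b\<in>carrier A. inv\<^bsub>A\<^esub> a \<otimes>\<^bsub>A\<^esub> (a \<otimes>\<^bsub>M\<^esub> b))"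

definition star ::
    "('a, 'b) monoid_scheme \<Rightarrow> ('a, 'c) monoid_scheme \<Rightarrow> 'a \<Rightarrow> 'a \<Rightarrow> 'a" where
  "star A M a b = lambda_map A M a b \<otimes>\<^bsub>A\<^esub> inv\<^bsub>A\<^esub> b"

definition add_commutator :: "('a, 'b) monoid_scheme \<Rightarrow> 'a \<Rightarrow> 'a \<Rightarrow> 'a" where
  "add_commutator A a b = a \<otimes>\<^bsub>A\<^esub> b \<otimes>\<^bsub>A\<^esub> inv\<^bsub>A\<^esub> a \<otimes>\<^bsub>A\<^esub> inv\<^bsub>A\<^esub> b"

definition sub_skew_brace ::
    "'a set \<Rightarrow> ('a, 'b) monoid_scheme \<Rightarrow> ('a, 'c) monoid_scheme \<Rightarrow> bool" where
  "sub_skew_brace H A M \<longleftrightarrow>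
     H \<subseteq> carrier A \<and> skew_left_brace (A\<lparr>carrier := H\<rparr>) (M\<lparr>carrier := H\<rparr>)"

definition brace_centralizer ::
    "('a, 'b) monoid_scheme \<Rightarrow> ('a, 'c) monoid_scheme \<Rightarrow> 'a \<Rightarrow> 'a set" where
  "brace_centralizer A M x =
     {b \<in> carrier A. star A M x b = \<one>\<^bsub>A\<^esub> \<and> star A M b x = \<one>\<^bsub>A\<^esub> \<and> add_commutator A x b = \<one>\<^bsub>A\<^esub>}"

text \<open>
  Finiteness of the index is finiteness of the set of cosets in \<open>(B,\<circ>)\<close>; a condition on
  \<^const>\<open>card\<close> would not do, since it is \<open>0\<close> on infinite sets.
\<close>

definition FCI :: "('a, 'b) monoid_scheme \<Rightarrow> ('a, 'c) monoid_scheme \<Rightarrow> 'a set" where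
  "FCI A M = {x \<in> carrier A. finite (rcosets\<^bsub>M\<^esub> (brace_centralizer A M x))}"

definition two_sided ::
    "('a, 'b) monoid_scheme \<Rightarrow> ('a, 'c) monoid_scheme \<Rightarrow> bool" where
  "two_sided A M \<longleftrightarrow>
     (\<forall>a\<in>carrier A. \<forall>b\<in>carrier A. \<forall>c\<in>carrier A.
        (b \<otimes>\<^bsub>A\<^esub> c) \<otimes>\<^bsub>M\<^esub> a = (b \<otimes>\<^bsub>M\<^esub> a) \<otimes>\<^bsub>A\<^esub> inv\<^bsub>A\<^esub> a \<otimes>\<^bsub>A\<^esub> (c \<otimes>\<^bsub>M\<^esub> a))"

definition symmetric_brace ::
    "('a, 'b) monoid_scheme \<Rightarrow> ('a, 'c) monoid_scheme \<Rightarrow> bool" where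
  "symmetric_brace A M \<longleftrightarrow> skew_left_brace M A"

definition lambda_homomorphic ::
    "('a, 'b) monoid_scheme \<Rightarrow> ('a, 'c) monoid_scheme \<Rightarrow> bool" where
  "lambda_homomorphic A M \<longleftrightarrow> lambda_map A M \<in> hom A (AutoGroup A)"

end

theory Submission
  imports Defs
begin

text \<open>
  The relation ``\<open>b\<close> lies in the brace centralizer of \<open>x\<close>'' is symmetric in \<open>b\<close> and \<open>x\<close>: it says
  that the four elements \<open>x + b\<close>, \<open>b + x\<close>, \<open>x \<circ> b\<close> and \<open>b \<circ> x\<close> are equal
  (\<open>mem_brace_centralizer_iff\<close>, \<open>brace_centralizer_sym\<close>). Closure properties of centralizers
  therefore turn into closure properties of FCI. If \<open>Cb(b)\<close> is closed under some binary
  operation for every \<open>b\<close> and \<open>z\<close> is the result of that operation on \<open>x\<close> and \<open>y\<close>, then any \<open>b\<close>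
  centralizing \<open>x\<close> and \<open>y\<close> has \<open>x\<close> and \<open>y\<close>, hence \<open>z\<close>, in its centralizer. So
  \<open>Cb(x) \<inter> Cb(y) \<subseteq> Cb(z)\<close>, and \<open>Cb(z)\<close> has finite index as soon as \<open>Cb(x)\<close> and \<open>Cb(y)\<close> have.
  Hence FCI is a subgroup for any group structure on \<open>B\<close> for which all centralizers are subgroups
  (\<open>subgroup_FCI\<close>).

  All centralizers are subgroups of \<open>(B,\<circ>)\<close> in any skew left brace
  (\<open>brace_centralizer_subgroup_circ\<close>). In \<open>(B,+)\<close>, the left brace law alone gives every part of
  closure except that \<open>\<lambda>\<^bsub>y+z\<^esub>\<close> and \<open>\<lambda>\<^bsub>-y\<^esub>\<close> fix \<open>x\<close> when \<open>\<lambda>\<^sub>y\<close> and \<open>\<lambda>\<^sub>z\<close> do; each of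
  the three extra hypotheses supplies this in its own way
  (\<open>brace_centralizer_subgroup_add\<close>).
\<close>

section \<open>Subgroups of finite index\<close>

text \<open>
  A coset of \<open>L\<close> is determined by the pair of cosets of \<open>H\<close> and \<open>K\<close> through any of its
  elements, because two elements that agree modulo \<open>H\<close> and modulo \<open>K\<close> agree modulo
  \<open>H \<inter> K\<close>. With \<open>H = K\<close> this is the statement that finite index passes to larger subgroups.
\<close>

lemma (in group) finite_rcosets_if_Int_subset:
  assumes H: "subgroup H G" and K: "subgroup K G" and L: "subgroup L G"
    and sub: "H \<inter> K \<subseteq> L"
    and finH: "finite (rcosets H)" and finK: "finite (rcosets K)"
  shows "finite (rcosets L)"
proof -
  define p where "p a = (H #> a, K #> a)" for a
  define s where "s q = (SOME a. a \<in> carrier G \<and> p a = q)" for q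
  have "p ` carrier G \<subseteq> (rcosets H) \<times> (rcosets K)"
    by (auto simp: p_def RCOSETS_def)
  then have fin: "finite (p ` carrier G)"
    by (rule finite_subset) (intro finite_cartesian_product finH finK)
  have same: "L #> a = L #> b" if a: "a \<in> carrier G" and b: "b \<in> carrier G" and ab: "p a = p b" for a b
  proof -
    have "a \<otimes> inv b \<in> H \<inter> K"
      using a b ab H K unfolding p_def
      by (metis IntI Pair_inject group.rcos_self is_group subgroup.rcos_module_imp)
    then have "a \<otimes> inv b \<in> L" using sub by blast
    then show ?thesis
      using a b L by (metis is_group repr_independence subgroup.rcos_module_rev)
  qed
  have "rcosets L \<subseteq> (\<lambda>q. L #> s q) ` (p ` carrier G)"
  proof
    fix C assume "C \<in> rcosets L"
    then obtain a where a: "a \<in> carrier G" and C: "C = L #> a" by (auto simp: RCOSETS_def)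
    have "s (p a) \<in> carrier G \<and> p (s (p a)) = p a"
      unfolding s_def by (rule someI_ex) (use a in blast)
    then have "C = L #> s (p a)" using same[of a "s (p a)"] a C by simp
    then show "C \<in> (\<lambda>q. L #> s q) ` (p ` carrier G)" using a by blast
  qed
  then show ?thesis using fin by (meson finite_imageI finite_subset)
qed

section \<open>Brace centralizers\<close>

context skew_left_brace
begin

lemma circ_closed [simp, intro]:
  "\<lbrakk>a \<in> carrier A; b \<in> carrier A\<rbrakk> \<Longrightarrow> a \<otimes>\<^bsub>M\<^esub> b \<in> carrier A"
  using circ.m_closed carrier_eq by simp

lemma circ_inv_closed [simp, intro]: "a \<in> carrier A \<Longrightarrow> inv\<^bsub>M\<^esub> a \<in> carrier A"
  using circ.inv_closed carrier_eq by simp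

lemma circ_assoc:
  "\<lbrakk>a \<in> carrier A; b \<in> carrier A; c \<in> carrier A\<rbrakk> \<Longrightarrow>
    a \<otimes>\<^bsub>M\<^esub> b \<otimes>\<^bsub>M\<^esub> c = a \<otimes>\<^bsub>M\<^esub> (b \<otimes>\<^bsub>M\<^esub> c)"
  using circ.m_assoc carrier_eq by simp

lemma add_inv_cancel [simp]:
  "\<lbrakk>a \<in> carrier A; b \<in> carrier A\<rbrakk> \<Longrightarrow> inv\<^bsub>A\<^esub> a \<otimes>\<^bsub>A\<^esub> (a \<otimes>\<^bsub>A\<^esub> b) = b"
  "\<lbrakk>a \<in> carrier A; b \<in> carrier A\<rbrakk> \<Longrightarrow> a \<otimes>\<^bsub>A\<^esub> (inv\<^bsub>A\<^esub> a \<otimes>\<^bsub>A\<^esub> b) = b"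
  by (simp_all add: add.m_assoc[symmetric])

lemma one_eq: "\<one>\<^bsub>M\<^esub> = \<one>\<^bsub>A\<^esub>"
proof -
  have M1: "\<one>\<^bsub>M\<^esub> \<in> carrier A" using circ.one_closed carrier_eq by simp
  have "\<one>\<^bsub>M\<^esub> \<otimes>\<^bsub>M\<^esub> (\<one>\<^bsub>A\<^esub> \<otimes>\<^bsub>A\<^esub> \<one>\<^bsub>A\<^esub>)
      = (\<one>\<^bsub>M\<^esub> \<otimes>\<^bsub>M\<^esub> \<one>\<^bsub>A\<^esub>) \<otimes>\<^bsub>A\<^esub> inv\<^bsub>A\<^esub> \<one>\<^bsub>M\<^esub> \<otimes>\<^bsub>A\<^esub> (\<one>\<^bsub>M\<^esub> \<otimes>\<^bsub>M\<^esub> \<one>\<^bsub>A\<^esub>)"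
    using M1 by (intro brace_law) auto
  then have "inv\<^bsub>A\<^esub> \<one>\<^bsub>M\<^esub> = \<one>\<^bsub>A\<^esub>"
    using M1 carrier_eq by (simp add: add.m_assoc)
  then show ?thesis using M1 by (metis add.inv_inv add.inv_one)
qed

lemma circ_one [simp]:
  "a \<in> carrier A \<Longrightarrow> a \<otimes>\<^bsub>M\<^esub> \<one>\<^bsub>A\<^esub> = a" "a \<in> carrier A \<Longrightarrow> \<one>\<^bsub>A\<^esub> \<otimes>\<^bsub>M\<^esub> a = a"
  using circ.r_one circ.l_one carrier_eq one_eq by simp_all

lemma circ_inv [simp]:
  "a \<in> carrier A \<Longrightarrow> a \<otimes>\<^bsub>M\<^esub> inv\<^bsub>M\<^esub> a = \<one>\<^bsub>A\<^esub>" "a \<in> carrier A \<Longrightarrow> inv\<^bsub>M\<^esub> a \<otimes>\<^bsub>M\<^esub> a = \<one>\<^bsub>A\<^esub>"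
  using circ.r_inv circ.l_inv carrier_eq one_eq by simp_all

lemma lambda_map_eq_iff:
  assumes "a \<in> carrier A" "b \<in> carrier A"
  shows "lambda_map A M a b = b \<longleftrightarrow> a \<otimes>\<^bsub>M\<^esub> b = a \<otimes>\<^bsub>A\<^esub> b"
  using assms by (auto simp: lambda_map_def add.inv_solve_left')

lemma star_eq_one_iff:
  assumes "a \<in> carrier A" "b \<in> carrier A"
  shows "star A M a b = \<one>\<^bsub>A\<^esub> \<longleftrightarrow> a \<otimes>\<^bsub>M\<^esub> b = a \<otimes>\<^bsub>A\<^esub> b"
proof -
  have "lambda_map A M a b \<in> carrier A" using assms by (simp add: lambda_map_def)
  then have "star A M a b = \<one>\<^bsub>A\<^esub> \<longleftrightarrow> lambda_map A M a b = b"
    using assms by (simp add: star_def add.inv_solve_right')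
  then show ?thesis using assms by (simp add: lambda_map_eq_iff)
qed

lemma add_commutator_eq_one_iff:
  assumes "a \<in> carrier A" "b \<in> carrier A"
  shows "add_commutator A a b = \<one>\<^bsub>A\<^esub> \<longleftrightarrow> a \<otimes>\<^bsub>A\<^esub> b = b \<otimes>\<^bsub>A\<^esub> a"
  using assms by (simp add: add_commutator_def add.inv_solve_right')

text \<open>
  Multiplicative equations are easier to combine with the brace law than the triviality of the
  three commutator-like elements, and they make the symmetry in \<open>b\<close> and \<open>x\<close> apparent.
\<close>

lemma mem_brace_centralizer_iff:
  assumes "x \<in> carrier A"
  shows "b \<in> brace_centralizer A M x \<longleftrightarrow>
    b \<in> carrier A \<and> x \<otimes>\<^bsub>M\<^esub> b = x \<otimes>\<^bsub>A\<^esub> b \<and> b \<otimes>\<^bsub>M\<^esub> x = b \<otimes>\<^bsub>A\<^esub> x \<and> x \<otimes>\<^bsub>A\<^esub> b = b \<otimes>\<^bsub>A\<^esub> x"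
  using assms
  by (auto simp: brace_centralizer_def star_eq_one_iff add_commutator_eq_one_iff)

lemma brace_centralizer_sym:
  assumes "x \<in> carrier A" "b \<in> brace_centralizer A M x"
  shows "x \<in> brace_centralizer A M b"
  using assms by (auto simp: mem_brace_centralizer_iff)

lemma brace_centralizer_carrier: "brace_centralizer A M x \<subseteq> carrier A"
  by (auto simp: brace_centralizer_def)

lemma one_in_brace_centralizer: "x \<in> carrier A \<Longrightarrow> \<one>\<^bsub>A\<^esub> \<in> brace_centralizer A M x"
  by (simp add: mem_brace_centralizer_iff)

lemma brace_centralizer_one: "brace_centralizer A M \<one>\<^bsub>A\<^esub> = carrier A"
  by (auto simp: mem_brace_centralizer_iff)

text \<open>
  The subtle point is additive commutation with \<open>x\<close>: it survives because \<open>\<lambda>\<^sub>b\<close> is additive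
  and fixes \<open>x\<close>, so it maps an element that commutes with \<open>x\<close> to another such element.
\<close>

lemma brace_centralizer_subgroup_circ:
  assumes x: "x \<in> carrier A"
  shows "subgroup (brace_centralizer A M x) M"
proof (rule circ.subgroupI)
  show "brace_centralizer A M x \<subseteq> carrier M"
    using brace_centralizer_carrier carrier_eq by simp
  show "brace_centralizer A M x \<noteq> {}" using one_in_brace_centralizer[OF x] by blast
next
  fix b assume b: "b \<in> brace_centralizer A M x"
  define d where "d = inv\<^bsub>M\<^esub> b"
  have bx: "b \<in> carrier A" "x \<otimes>\<^bsub>M\<^esub> b = x \<otimes>\<^bsub>A\<^esub> b" "b \<otimes>\<^bsub>M\<^esub> x = b \<otimes>\<^bsub>A\<^esub> x" "x \<otimes>\<^bsub>A\<^esub> b = b \<otimes>\<^bsub>A\<^esub> x"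
    using b x by (simp_all add: mem_brace_centralizer_iff)
  have d: "d \<in> carrier A" "d \<otimes>\<^bsub>M\<^esub> b = \<one>\<^bsub>A\<^esub>" "b \<otimes>\<^bsub>M\<^esub> d = \<one>\<^bsub>A\<^esub>" using bx by (simp_all add: d_def)
  have "b \<otimes>\<^bsub>M\<^esub> (d \<otimes>\<^bsub>A\<^esub> x) = x"
    using bx d x by (simp add: brace_law add.m_assoc)
  then have "d \<otimes>\<^bsub>M\<^esub> x = d \<otimes>\<^bsub>M\<^esub> (b \<otimes>\<^bsub>M\<^esub> (d \<otimes>\<^bsub>A\<^esub> x))" by simp
  also have "\<dots> = d \<otimes>\<^bsub>A\<^esub> x" using bx d x by (simp add: circ_assoc[symmetric])
  finally have dx: "d \<otimes>\<^bsub>M\<^esub> x = d \<otimes>\<^bsub>A\<^esub> x" .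
  have "d \<otimes>\<^bsub>A\<^esub> x \<otimes>\<^bsub>A\<^esub> inv\<^bsub>A\<^esub> d = d \<otimes>\<^bsub>M\<^esub> (x \<otimes>\<^bsub>A\<^esub> b)"
    using bx(1) d dx x by (simp add: brace_law)
  also have "\<dots> = d \<otimes>\<^bsub>M\<^esub> (b \<otimes>\<^bsub>A\<^esub> x)" using bx(4) by simp
  also have "\<dots> = x" using bx(1) d dx x by (simp add: brace_law)
  finally have comm: "x \<otimes>\<^bsub>A\<^esub> d = d \<otimes>\<^bsub>A\<^esub> x"
    using d x by (metis add.inv_solve_right add.m_closed)
  have "x \<otimes>\<^bsub>M\<^esub> d = (d \<otimes>\<^bsub>M\<^esub> b) \<otimes>\<^bsub>M\<^esub> x \<otimes>\<^bsub>M\<^esub> d" using d x by simp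
  also have "\<dots> = d \<otimes>\<^bsub>M\<^esub> (x \<otimes>\<^bsub>M\<^esub> b) \<otimes>\<^bsub>M\<^esub> d" using bx d(1) x by (simp add: circ_assoc)
  also have "\<dots> = d \<otimes>\<^bsub>M\<^esub> x \<otimes>\<^bsub>M\<^esub> (b \<otimes>\<^bsub>M\<^esub> d)" using bx(1) d(1) x by (simp add: circ_assoc)
  also have "\<dots> = d \<otimes>\<^bsub>M\<^esub> x" using d x by simp
  finally have "x \<otimes>\<^bsub>M\<^esub> d = d \<otimes>\<^bsub>M\<^esub> x" .
  then show "inv\<^bsub>M\<^esub> b \<in> brace_centralizer A M x"
    using d dx comm x by (simp add: mem_brace_centralizer_iff flip: d_def)
next
  fix b c assume b: "b \<in> brace_centralizer A M x" and c: "c \<in> brace_centralizer A M x"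
  have bx: "b \<in> carrier A" "x \<otimes>\<^bsub>M\<^esub> b = x \<otimes>\<^bsub>A\<^esub> b" "b \<otimes>\<^bsub>M\<^esub> x = b \<otimes>\<^bsub>A\<^esub> x" "x \<otimes>\<^bsub>A\<^esub> b = b \<otimes>\<^bsub>A\<^esub> x"
    using b x by (simp_all add: mem_brace_centralizer_iff)
  have cx: "c \<in> carrier A" "x \<otimes>\<^bsub>M\<^esub> c = x \<otimes>\<^bsub>A\<^esub> c" "c \<otimes>\<^bsub>M\<^esub> x = c \<otimes>\<^bsub>A\<^esub> x" "x \<otimes>\<^bsub>A\<^esub> c = c \<otimes>\<^bsub>A\<^esub> x"
    using c x by (simp_all add: mem_brace_centralizer_iff)
  let ?d = "b \<otimes>\<^bsub>M\<^esub> c"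
  have via_cx: "b \<otimes>\<^bsub>M\<^esub> (c \<otimes>\<^bsub>A\<^esub> x) = ?d \<otimes>\<^bsub>A\<^esub> x"
    using bx(1,3) cx(1) x by (simp add: brace_law add.m_assoc)
  have "b \<otimes>\<^bsub>M\<^esub> (x \<otimes>\<^bsub>A\<^esub> c) = x \<otimes>\<^bsub>A\<^esub> b \<otimes>\<^bsub>A\<^esub> inv\<^bsub>A\<^esub> b \<otimes>\<^bsub>A\<^esub> ?d"
    using bx cx(1) x by (simp add: brace_law)
  also have "\<dots> = x \<otimes>\<^bsub>A\<^esub> ?d" using bx(1) cx(1) x by (simp add: add.m_assoc)
  finally have via_xc: "b \<otimes>\<^bsub>M\<^esub> (x \<otimes>\<^bsub>A\<^esub> c) = x \<otimes>\<^bsub>A\<^esub> ?d" .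
  have comm: "x \<otimes>\<^bsub>A\<^esub> ?d = ?d \<otimes>\<^bsub>A\<^esub> x" using via_cx via_xc cx(4) by simp
  have dx: "?d \<otimes>\<^bsub>M\<^esub> x = ?d \<otimes>\<^bsub>A\<^esub> x" using via_cx bx(1) cx x by (simp add: circ_assoc)
  have "x \<otimes>\<^bsub>M\<^esub> ?d = b \<otimes>\<^bsub>M\<^esub> x \<otimes>\<^bsub>M\<^esub> c" using bx cx(1) x by (simp flip: circ_assoc)
  also have "\<dots> = x \<otimes>\<^bsub>A\<^esub> ?d" using via_xc bx(1) cx(1,2) x by (simp add: circ_assoc)
  finally show "?d \<in> brace_centralizer A M x"
    using comm dx bx(1) cx(1) x by (simp add: mem_brace_centralizer_iff)
qed

text \<open>
  The hypotheses on sums and negatives read \<open>\<lambda>\<^bsub>y+z\<^esub>(x) = x\<close> and \<open>\<lambda>\<^bsub>-y\<^esub>(x) = x\<close>. The other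
  conditions for membership in \<open>Cb(x)\<close> follow from additivity of \<open>\<lambda>\<^sub>x\<close>
  and from additive centralizers being subgroups.
\<close>

lemma brace_centralizer_subgroup_addI:
  assumes x: "x \<in> carrier A"
    and sum: "\<And>y z. \<lbrakk>y \<in> brace_centralizer A M x; z \<in> brace_centralizer A M x\<rbrakk> \<Longrightarrow>
      (y \<otimes>\<^bsub>A\<^esub> z) \<otimes>\<^bsub>M\<^esub> x = y \<otimes>\<^bsub>A\<^esub> z \<otimes>\<^bsub>A\<^esub> x"
    and neg: "\<And>y. y \<in> brace_centralizer A M x \<Longrightarrow> inv\<^bsub>A\<^esub> y \<otimes>\<^bsub>M\<^esub> x = inv\<^bsub>A\<^esub> y \<otimes>\<^bsub>A\<^esub> x"
  shows "subgroup (brace_centralizer A M x) A"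
proof (rule add.subgroupI)
  show "brace_centralizer A M x \<subseteq> carrier A" by (rule brace_centralizer_carrier)
  show "brace_centralizer A M x \<noteq> {}" using one_in_brace_centralizer[OF x] by blast
next
  fix y assume y: "y \<in> brace_centralizer A M x"
  have yx: "y \<in> carrier A" "x \<otimes>\<^bsub>M\<^esub> y = x \<otimes>\<^bsub>A\<^esub> y" "x \<otimes>\<^bsub>A\<^esub> y = y \<otimes>\<^bsub>A\<^esub> x"
    using y x by (simp_all add: mem_brace_centralizer_iff)
  have comm: "x \<otimes>\<^bsub>A\<^esub> inv\<^bsub>A\<^esub> y = inv\<^bsub>A\<^esub> y \<otimes>\<^bsub>A\<^esub> x"
    using yx x by (metis add.inv_closed add.inv_solve_left add.inv_solve_right add.m_assoc add.m_closed)
  have "x \<otimes>\<^bsub>M\<^esub> (y \<otimes>\<^bsub>A\<^esub> inv\<^bsub>A\<^esub> y) = y \<otimes>\<^bsub>A\<^esub> x \<otimes>\<^bsub>A\<^esub> inv\<^bsub>A\<^esub> x \<otimes>\<^bsub>A\<^esub> (x \<otimes>\<^bsub>M\<^esub> inv\<^bsub>A\<^esub> y)"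
    using yx x by (subst brace_law) simp_all
  then have "x = y \<otimes>\<^bsub>A\<^esub> (x \<otimes>\<^bsub>M\<^esub> inv\<^bsub>A\<^esub> y)" using yx(1) x by (simp add: add.m_assoc)
  then have "x \<otimes>\<^bsub>M\<^esub> inv\<^bsub>A\<^esub> y = inv\<^bsub>A\<^esub> y \<otimes>\<^bsub>A\<^esub> x"
    using yx(1) x by (metis add.inv_closed add_inv_cancel(1) circ_closed)
  then show "inv\<^bsub>A\<^esub> y \<in> brace_centralizer A M x"
    using comm neg[OF y] yx(1) x by (simp add: mem_brace_centralizer_iff)
next
  fix y z assume y: "y \<in> brace_centralizer A M x" and z: "z \<in> brace_centralizer A M x"
  have yx: "y \<in> carrier A" "x \<otimes>\<^bsub>M\<^esub> y = x \<otimes>\<^bsub>A\<^esub> y" "x \<otimes>\<^bsub>A\<^esub> y = y \<otimes>\<^bsub>A\<^esub> x"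
    using y x by (simp_all add: mem_brace_centralizer_iff)
  have zx: "z \<in> carrier A" "x \<otimes>\<^bsub>M\<^esub> z = x \<otimes>\<^bsub>A\<^esub> z" "x \<otimes>\<^bsub>A\<^esub> z = z \<otimes>\<^bsub>A\<^esub> x"
    using z x by (simp_all add: mem_brace_centralizer_iff)
  have "x \<otimes>\<^bsub>A\<^esub> (y \<otimes>\<^bsub>A\<^esub> z) = y \<otimes>\<^bsub>A\<^esub> x \<otimes>\<^bsub>A\<^esub> z" using yx zx(1) x by (simp flip: add.m_assoc)
  also have "\<dots> = y \<otimes>\<^bsub>A\<^esub> z \<otimes>\<^bsub>A\<^esub> x" using yx(1) zx x by (simp add: add.m_assoc)
  finally have comm: "x \<otimes>\<^bsub>A\<^esub> (y \<otimes>\<^bsub>A\<^esub> z) = y \<otimes>\<^bsub>A\<^esub> z \<otimes>\<^bsub>A\<^esub> x" .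
  have "x \<otimes>\<^bsub>M\<^esub> (y \<otimes>\<^bsub>A\<^esub> z) = x \<otimes>\<^bsub>A\<^esub> (y \<otimes>\<^bsub>A\<^esub> z)"
    using yx(1,2) zx(1,2) x by (simp add: brace_law add.m_assoc)
  then show "y \<otimes>\<^bsub>A\<^esub> z \<in> brace_centralizer A M x"
    using comm sum[OF y z] yx(1) zx(1) x by (simp add: mem_brace_centralizer_iff)
qed

text \<open>
  The right brace law makes \<open>u \<mapsto> (u \<circ> x) - x\<close> an endomorphism of \<open>(B,+)\<close>; its fixed points, the
  \<open>u\<close> with \<open>u \<circ> x = u + x\<close>, therefore form a subgroup.
\<close>

lemma brace_centralizer_subgroup_add_two_sided:
  assumes ts: "two_sided A M" and x: "x \<in> carrier A"
  shows "subgroup (brace_centralizer A M x) A"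
proof (rule brace_centralizer_subgroup_addI[OF x])
  have law: "(b \<otimes>\<^bsub>A\<^esub> c) \<otimes>\<^bsub>M\<^esub> x = (b \<otimes>\<^bsub>M\<^esub> x) \<otimes>\<^bsub>A\<^esub> inv\<^bsub>A\<^esub> x \<otimes>\<^bsub>A\<^esub> (c \<otimes>\<^bsub>M\<^esub> x)"
    if "b \<in> carrier A" "c \<in> carrier A" for b c
    using ts that x by (simp add: two_sided_def)
  show "(y \<otimes>\<^bsub>A\<^esub> z) \<otimes>\<^bsub>M\<^esub> x = y \<otimes>\<^bsub>A\<^esub> z \<otimes>\<^bsub>A\<^esub> x"
    if "y \<in> brace_centralizer A M x" "z \<in> brace_centralizer A M x" for y z
    using that x law[of y z] by (simp add: mem_brace_centralizer_iff add.m_assoc)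
  fix y assume "y \<in> brace_centralizer A M x"
  then have y: "y \<in> carrier A" "y \<otimes>\<^bsub>M\<^esub> x = x \<otimes>\<^bsub>A\<^esub> y" "x \<otimes>\<^bsub>A\<^esub> y = y \<otimes>\<^bsub>A\<^esub> x"
    using x by (simp_all add: mem_brace_centralizer_iff)
  have "x = (inv\<^bsub>A\<^esub> y \<otimes>\<^bsub>M\<^esub> x) \<otimes>\<^bsub>A\<^esub> inv\<^bsub>A\<^esub> x \<otimes>\<^bsub>A\<^esub> (x \<otimes>\<^bsub>A\<^esub> y)"
    using law[of "inv\<^bsub>A\<^esub> y" y] y(1,2) x by simp
  also have "\<dots> = (inv\<^bsub>A\<^esub> y \<otimes>\<^bsub>M\<^esub> x) \<otimes>\<^bsub>A\<^esub> y" using y(1) x by (simp add: add.m_assoc)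
  finally have "inv\<^bsub>A\<^esub> y \<otimes>\<^bsub>M\<^esub> x = x \<otimes>\<^bsub>A\<^esub> inv\<^bsub>A\<^esub> y"
    using y(1) x by (metis add.inv_closed add.inv_solve_right circ_closed)
  also have "\<dots> = inv\<^bsub>A\<^esub> y \<otimes>\<^bsub>A\<^esub> x"
    using y x by (metis add.inv_closed add.inv_solve_left add.inv_solve_right add.m_assoc add.m_closed)
  finally show "inv\<^bsub>A\<^esub> y \<otimes>\<^bsub>M\<^esub> x = inv\<^bsub>A\<^esub> y \<otimes>\<^bsub>A\<^esub> x" .
qed

text \<open>
  The exchanged brace law \<open>u + (v \<circ> w) = (u + v) \<circ> u' \<circ> (u + w)\<close>, where \<open>u'\<close> is the inverse
  of \<open>u\<close> in \<open>(B,\<circ>)\<close>, is applied with \<open>w = x\<close>. For \<open>u = y\<close>, \<open>v = z\<close> the last two factors collapse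
  to \<open>x\<close>; for \<open>u = -y\<close>, \<open>v = y\<close> the first factor is the identity.
\<close>

lemma brace_centralizer_subgroup_add_symmetric:
  assumes sym: "symmetric_brace A M" and x: "x \<in> carrier A"
  shows "subgroup (brace_centralizer A M x) A"
proof (rule brace_centralizer_subgroup_addI[OF x])
  have law: "u \<otimes>\<^bsub>A\<^esub> (v \<otimes>\<^bsub>M\<^esub> w) = (u \<otimes>\<^bsub>A\<^esub> v) \<otimes>\<^bsub>M\<^esub> inv\<^bsub>M\<^esub> u \<otimes>\<^bsub>M\<^esub> (u \<otimes>\<^bsub>A\<^esub> w)"
    if "u \<in> carrier A" "v \<in> carrier A" "w \<in> carrier A" for u v w
    using skew_left_brace.brace_law[of M A u v w] sym that carrier_eq
    by (simp add: symmetric_brace_def)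
  show "(y \<otimes>\<^bsub>A\<^esub> z) \<otimes>\<^bsub>M\<^esub> x = y \<otimes>\<^bsub>A\<^esub> z \<otimes>\<^bsub>A\<^esub> x"
    if y: "y \<in> brace_centralizer A M x" and z: "z \<in> brace_centralizer A M x" for y z
  proof -
    have yx: "y \<in> carrier A" "y \<otimes>\<^bsub>A\<^esub> x = y \<otimes>\<^bsub>M\<^esub> x"
      and zx: "z \<in> carrier A" "z \<otimes>\<^bsub>M\<^esub> x = z \<otimes>\<^bsub>A\<^esub> x"
      using y z x by (simp_all add: mem_brace_centralizer_iff)
    have "y \<otimes>\<^bsub>A\<^esub> (z \<otimes>\<^bsub>M\<^esub> x) = (y \<otimes>\<^bsub>A\<^esub> z) \<otimes>\<^bsub>M\<^esub> inv\<^bsub>M\<^esub> y \<otimes>\<^bsub>M\<^esub> (y \<otimes>\<^bsub>M\<^esub> x)"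
      using law[of y z x] yx zx(1) x by simp
    also have "\<dots> = (y \<otimes>\<^bsub>A\<^esub> z) \<otimes>\<^bsub>M\<^esub> ((inv\<^bsub>M\<^esub> y \<otimes>\<^bsub>M\<^esub> y) \<otimes>\<^bsub>M\<^esub> x)"
      using yx(1) zx(1) x by (simp add: circ_assoc del: circ_inv)
    also have "\<dots> = (y \<otimes>\<^bsub>A\<^esub> z) \<otimes>\<^bsub>M\<^esub> x" using yx(1) x by simp
    finally show ?thesis using yx(1) zx x by (simp add: add.m_assoc)
  qed
  fix y assume "y \<in> brace_centralizer A M x"
  then have y: "y \<in> carrier A" "y \<otimes>\<^bsub>M\<^esub> x = y \<otimes>\<^bsub>A\<^esub> x"
    using x by (simp_all add: mem_brace_centralizer_iff)
  let ?n = "inv\<^bsub>A\<^esub> y"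
  have "x = inv\<^bsub>M\<^esub> ?n \<otimes>\<^bsub>M\<^esub> (?n \<otimes>\<^bsub>A\<^esub> x)" using law[of ?n y x] y x by simp
  then have "?n \<otimes>\<^bsub>M\<^esub> x = ?n \<otimes>\<^bsub>M\<^esub> (inv\<^bsub>M\<^esub> ?n \<otimes>\<^bsub>M\<^esub> (?n \<otimes>\<^bsub>A\<^esub> x))" by simp
  also have "\<dots> = ?n \<otimes>\<^bsub>A\<^esub> x" using y(1) x by (simp flip: circ_assoc)
  finally show "?n \<otimes>\<^bsub>M\<^esub> x = ?n \<otimes>\<^bsub>A\<^esub> x" .
qed

text \<open>
  Here \<open>\<lambda>\<close> is an action of \<open>(B,+)\<close>, and the elements \<open>y\<close> with \<open>y \<circ> x = y + x\<close> form the
  stabilizer of \<open>x\<close>.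
\<close>

lemma brace_centralizer_subgroup_add_lambda_homomorphic:
  assumes lh: "lambda_homomorphic A M" and x: "x \<in> carrier A"
  shows "subgroup (brace_centralizer A M x) A"
proof (rule brace_centralizer_subgroup_addI[OF x])
  have lam: "lambda_map A M (u \<otimes>\<^bsub>A\<^esub> v) w = lambda_map A M u (lambda_map A M v w)"
    if u: "u \<in> carrier A" and v: "v \<in> carrier A" and w: "w \<in> carrier A" for u v w
  proof -
    have hom: "lambda_map A M \<in> hom A (AutoGroup A)" using lh by (simp add: lambda_homomorphic_def)
    have Bij: "lambda_map A M a \<in> Bij (carrier A)" if "a \<in> carrier A" for a
      using hom_in_carrier[OF hom that] by (simp add: AutoGroup_def auto_def)
    show ?thesis
      using hom_mult[OF hom u v] Bij[OF u] Bij[OF v] w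
      by (simp add: AutoGroup_def BijGroup_def compose_eq)
  qed
  have fix_iff: "y \<otimes>\<^bsub>M\<^esub> x = y \<otimes>\<^bsub>A\<^esub> x \<longleftrightarrow> lambda_map A M y x = x" if "y \<in> carrier A" for y
    using lambda_map_eq_iff[OF that x] by simp
  have fixes_x: "y \<in> carrier A" "lambda_map A M y x = x" if "y \<in> brace_centralizer A M x" for y
    using that x by (simp_all add: mem_brace_centralizer_iff lambda_map_eq_iff)
  show "(y \<otimes>\<^bsub>A\<^esub> z) \<otimes>\<^bsub>M\<^esub> x = y \<otimes>\<^bsub>A\<^esub> z \<otimes>\<^bsub>A\<^esub> x"
    if "y \<in> brace_centralizer A M x" "z \<in> brace_centralizer A M x" for y z
    using fixes_x[OF that(1)] fixes_x[OF that(2)] x by (simp add: fix_iff lam)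
  fix y assume "y \<in> brace_centralizer A M x"
  note y = fixes_x[OF this]
  have "lambda_map A M (inv\<^bsub>A\<^esub> y) x = lambda_map A M (inv\<^bsub>A\<^esub> y \<otimes>\<^bsub>A\<^esub> y) x"
    using lam[of "inv\<^bsub>A\<^esub> y" y x] y x by simp
  also have "\<dots> = x" using y(1) x by (simp add: lambda_map_eq_iff)
  finally show "inv\<^bsub>A\<^esub> y \<otimes>\<^bsub>M\<^esub> x = inv\<^bsub>A\<^esub> y \<otimes>\<^bsub>A\<^esub> x" using y(1) by (simp add: fix_iff)
qed

lemma brace_centralizer_subgroup_add:
  assumes "two_sided A M \<or> symmetric_brace A M \<or> lambda_homomorphic A M" "x \<in> carrier A"
  shows "subgroup (brace_centralizer A M x) A"
  using assms brace_centralizer_subgroup_add_two_sided brace_centralizer_subgroup_add_symmetric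
    brace_centralizer_subgroup_add_lambda_homomorphic by blast

section \<open>Elements with finitely many centralizer cosets\<close>

text \<open>
  By symmetry of centralization, \<open>z \<in> Cb(b)\<close> may be checked instead of \<open>b \<in> Cb(z)\<close>, which is
  the form in which closure of centralizers applies.
\<close>

lemma FCI_memI:
  assumes x: "x \<in> FCI A M" and y: "y \<in> FCI A M" and z: "z \<in> carrier A"
    and cl: "\<And>b. \<lbrakk>b \<in> carrier A; x \<in> brace_centralizer A M b; y \<in> brace_centralizer A M b\<rbrakk> \<Longrightarrow>
      z \<in> brace_centralizer A M b"
  shows "z \<in> FCI A M"
proof -
  have xy: "x \<in> carrier A" "y \<in> carrier A" using x y by (auto simp: FCI_def)
  have "brace_centralizer A M x \<inter> brace_centralizer A M y \<subseteq> brace_centralizer A M z"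
    using xy cl brace_centralizer_sym brace_centralizer_carrier by blast
  then have "finite (rcosets\<^bsub>M\<^esub> brace_centralizer A M z)"
    using circ.finite_rcosets_if_Int_subset[of "brace_centralizer A M x"
        "brace_centralizer A M y" "brace_centralizer A M z"]
      brace_centralizer_subgroup_circ xy z x y
    by (simp add: FCI_def)
  then show ?thesis using z by (simp add: FCI_def)
qed

lemma one_in_FCI: "\<one>\<^bsub>A\<^esub> \<in> FCI A M"
proof -
  have "rcosets\<^bsub>M\<^esub> (carrier M) \<subseteq> {carrier M}"
    using circ.coset_join2[OF _ circ.subgroup_self] by (auto simp: RCOSETS_def)
  then show ?thesis
    using finite_subset by (auto simp: FCI_def brace_centralizer_one carrier_eq)
qed

text \<open>
  Here \<open>G\<close> is any group structure on \<open>B\<close>, so that the same argument serves both \<open>(B,\<circ>)\<close> and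
  \<open>(B,+)\<close>; the index in the definition of FCI is taken in \<open>(B,\<circ>)\<close> in either case.
\<close>

lemma subgroup_FCI:
  assumes G: "group G" and carr: "carrier G = carrier A"
    and sub: "\<And>b. b \<in> carrier A \<Longrightarrow> subgroup (brace_centralizer A M b) G"
  shows "subgroup (FCI A M) G"
proof (rule group.subgroupI[OF G])
  show "FCI A M \<subseteq> carrier G" by (auto simp: FCI_def carr)
  show "FCI A M \<noteq> {}" using one_in_FCI by blast
next
  fix x assume x: "x \<in> FCI A M"
  then have "x \<in> carrier G" by (simp add: FCI_def carr)
  then have "inv\<^bsub>G\<^esub> x \<in> carrier A" using group.inv_closed[OF G] carr by metis
  then show "inv\<^bsub>G\<^esub> x \<in> FCI A M" using FCI_memI[OF x x] subgroup.m_inv_closed[OF sub] by blast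
next
  fix x y assume x: "x \<in> FCI A M" and y: "y \<in> FCI A M"
  then have "x \<in> carrier G" "y \<in> carrier G" by (simp_all add: FCI_def carr)
  then have "x \<otimes>\<^bsub>G\<^esub> y \<in> carrier A"
    using monoid.m_closed[OF group.is_monoid[OF G]] carr by metis
  then show "x \<otimes>\<^bsub>G\<^esub> y \<in> FCI A M" using FCI_memI[OF x y] subgroup.m_closed[OF sub] by blast
qed

lemma sub_skew_braceI:
  assumes HA: "subgroup H A" and HM: "subgroup H M"
  shows "sub_skew_brace H A M"
proof -
  have carr: "h \<in> carrier A" if "h \<in> H" for h using that subgroup.subset[OF HA] by blast
  have "skew_left_brace (A\<lparr>carrier := H\<rparr>) (M\<lparr>carrier := H\<rparr>)"
    by (intro skew_left_brace.intro skew_left_brace_axioms.intro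
          add.subgroup_imp_group circ.subgroup_imp_group HA HM)
      (simp_all add: carr brace_law add.m_inv_consistent[OF HA])
  then show ?thesis using subgroup.subset[OF HA] by (simp add: sub_skew_brace_def)
qed

end

theorem proposition2p3:
  fixes A :: "('a, 'b) monoid_scheme" and M :: "('a, 'c) monoid_scheme"
  assumes "skew_left_brace A M"
  shows "subgroup (FCI A M) M \<and>
    (two_sided A M \<or> symmetric_brace A M \<or> lambda_homomorphic A M \<longrightarrow>
      sub_skew_brace (FCI A M) A M)"
proof -
  interpret skew_left_brace A M by fact
  have M: "subgroup (FCI A M) M"
    by (intro subgroup_FCI circ.is_group carrier_eq brace_centralizer_subgroup_circ)
  have "subgroup (FCI A M) A"
    if "two_sided A M \<or> symmetric_brace A M \<or> lambda_homomorphic A M"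
    by (intro subgroup_FCI add.is_group refl brace_centralizer_subgroup_add[OF that])
  then show ?thesis using M sub_skew_braceI by blast
qed

end
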